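(* Let $\Omega$ and $Y$ be proper subdomains of $\mathbb{C}$. Suppose that for every $b\in\Omega$ there exist a point $a\in Y$ and a holomorphic covering map $h_b$ from $Y\setminus\{a\}$ onto $\Omega\setminus\{b\}$ that extends to a holomorphic map of $Y$ onto $\Omega$ with $h_b(a)=b$ and $h_b'(a)\neq0$. Then $$\eta_\Omega^Y(w)=\eta_\Omega(w)\quad\text{for all } w\in\Omega.$$ In particular, for every proper subdomain $\Omega$ of $\mathbb{C}$, $\eta_\Omega^\Omega(w)=\eta_\Omega(w)$ for every $w\in\Omega$.
   Context: A domain is a nonempty connected open subset of $\mathbb{C}$; $\mathbb{D}$ is the open unit disk. For a proper subdomain $\Omega\subsetneq\mathbb{C}$ and $w\in\Omega$, let $\mathcal{H}(w,\Omega)$ be the family of holomorphic functions $h:\mathbb{D}\to\Omega$ with $h(0)=w$, $h(t)\neq w$ for all $t\in\mathbb{D}\setminus\{0\}$, and $h'(0)>0$. The Hurwitz density of $\Omega$ is $\eta_\Omega(w)=2/r_\Omega(w)$, where $r_\Omega(w)=\max\{h'(0):h\in\mathcal{H}(w,\Omega)\}$. For a proper subdomain $Y\subsetneq\mathbb{C}$ and any domain $\Omega\subset\mathbb{C}$, the generalized Hurwitz density of $\Omega$ with basepoint domain $Y$ is $\eta_\Omega^Y(w)=\inf \eta_Y(s)/|h'(s)|$, the infimum being over all $s\in Y$ and all holomorphic $h:Y\to\Omega$ with $h(s)=w$, $h(t)\ne w$ for all $t\in Y\setminus\{s\}$, and $h'(s)\neq0$; it may equal $+\infty$ (infimum over the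 empty set). *)

theory Defs
  imports "HOL-Analysis.Analysis"
begin

definition plane_domain :: "complex set \<Rightarrow> bool" where
  "plane_domain \<Omega> \<longleftrightarrow> \<Omega> \<noteq> {} \<and> open \<Omega> \<and> connected \<Omega>"

definition proper_subdomain :: "complex set \<Rightarrow> bool" where
  "proper_subdomain \<Omega> \<longleftrightarrow> plane_domain \<Omega> \<and> \<Omega> \<noteq> UNIV"

text \<open>Functions are total on the complex plane, so each map of the family occurs here with
  all its extensions beyond the unit disk; the values outside the disk play no role.\<close>

definition hurwitz_family :: "complex \<Rightarrow> complex set \<Rightarrow> (complex \<Rightarrow> complex) set" where
  "hurwitz_family w \<Omega> =
     {h. h holomorphic_on ball 0 1 \<and> h ` ball 0 1 \<subseteq> \<Omega> \<and> h 0 = w \<and>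
         (\<forall>t \<in> ball 0 1 - {0}. h t \<noteq> w) \<and>
         deriv h 0 \<in> \<real> \<and> Re (deriv h 0) > 0}"

text \<open>\<open>GREATEST\<close> expresses an attained maximum, as opposed to a supremum. The maximum exists
  for a proper subdomain \<open>\<Omega>\<close> and \<open>w \<in> \<Omega>\<close>; the value is unspecified where there is none.\<close>

definition hurwitz_radius :: "complex set \<Rightarrow> complex \<Rightarrow> real" where
  "hurwitz_radius \<Omega> w =
     (GREATEST r. r \<in> (\<lambda>h. Re (deriv h 0)) ` hurwitz_family w \<Omega>)"

definition hurwitz_density :: "complex set \<Rightarrow> complex \<Rightarrow> real" where
  "hurwitz_density \<Omega> w = 2 / hurwitz_radius \<Omega> w"

text \<open>The infimum is taken in the extended reals, so that it is \<open>\<infinity>\<close> over the empty set.\<close>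

definition gen_hurwitz_density :: "complex set \<Rightarrow> complex set \<Rightarrow> complex \<Rightarrow> ereal" where
  "gen_hurwitz_density Y \<Omega> w =
     Inf {ereal (hurwitz_density Y s / norm (deriv h s)) | s h.
            s \<in> Y \<and> h holomorphic_on Y \<and> h ` Y \<subseteq> \<Omega> \<and> h s = w \<and>
            (\<forall>t \<in> Y - {s}. h t \<noteq> w) \<and> deriv h s \<noteq> 0}"

end

theory Submission
  imports Defs "HOL-Complex_Analysis.Complex_Analysis"
begin

text \<open>
  The maximum defining the Hurwitz radius is attained: after normalisation the family consists of
  functions omitting 0 and 1 on the punctured disk, so Schottky-type bounds and Montel's theorem
  give a convergent maximising sequence, and Hurwitz's theorem keeps the limit in the family.
  Composing an extremal map of the disk into \<open>Y\<close> with a competitor \<open>Y \<rightarrow> \<Omega>\<close> gives one inequality.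
  For the other, an extremal map of the disk into \<open>\<Omega>\<close> is lifted through the covering \<open>h\<^sub>w\<close>. The lift
  exists on the punctured disk because every loop there shrinks towards the puncture, where
  \<open>h\<^sub>w\<close> has a local inverse; the same local inverse shows that it extends holomorphically.
\<close>

section \<open>Uniform bounds for functions on the disc that vanish only at 0 and omit 1\<close>

text \<open>If \<open>\<bar>g\<bar> > 1\<close> on the circle, then the image of the disk inside it meets the closed unit disk in
  a clopen set containing 0, hence contains the omitted value 1.\<close>
lemma small_value_on_circle:
  assumes r: "0 < r" "r < 1"
    and hol: "g holomorphic_on ball 0 1" and g0: "g 0 = 0"
    and nz: "\<And>t. t \<in> ball 0 1 - {0} \<Longrightarrow> g t \<noteq> 0"
    and n1: "\<And>t. t \<in> ball 0 1 \<Longrightarrow> g t \<noteq> 1"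
  shows "\<exists>t. norm t = r \<and> norm (g t) \<le> 1"
proof (rule ccontr)
  assume "\<not> ?thesis"
  then have large: "norm (g t) > 1" if "norm t = r" for t
    using that by force
  have sub: "cball 0 r \<subseteq> ball (0::complex) 1"
    using r by auto
  have "\<not> g constant_on ball 0 1"
  proof
    assume "g constant_on ball 0 1"
    then have "g (of_real r) = g 0"
      using r unfolding constant_on_def by (force simp: dist_norm)
    then show False
      using nz[of "of_real r"] g0 r by auto
  qed
  then have op: "open (g ` ball 0 r)"
    using r by (intro open_mapping_thm[OF hol]) auto
  \<comment> \<open>The left side is relatively open by the open mapping theorem, the right side is
    closed by compactness. They agree because points of the bounding circle have values outside
    \<open>cball 0 1\<close>.\<close>
  have eq: "cball 0 1 \<inter> g ` ball 0 r = cball 0 1 \<inter> g ` cball 0 r"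
  proof (intro equalityI subsetI)
    fix y assume y: "y \<in> cball 0 1 \<inter> g ` cball 0 r"
    then obtain t where t: "norm t \<le> r" "y = g t" by auto
    then have "norm t \<noteq> r"
      using large[of t] y by auto
    then show "y \<in> cball 0 1 \<inter> g ` ball 0 r"
      using y t by auto
  qed auto
  have "compact (g ` cball 0 r)"
    using hol sub by (meson compact_cball compact_continuous_image continuous_on_subset
        holomorphic_on_imp_continuous_on)
  then have "closedin (top_of_set (cball 0 1)) (cball 0 1 \<inter> g ` ball 0 r)"
    unfolding eq by (simp add: closedin_closed_Int compact_imp_closed)
  moreover have "openin (top_of_set (cball 0 1)) (cball 0 1 \<inter> g ` ball 0 r)"
    using op by (simp add: openin_open_Int)
  moreover have "0 \<in> cball 0 1 \<inter> g ` ball 0 r"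
    using g0 r by (auto simp: image_iff intro!: bexI[of _ 0])
  ultimately have "cball 0 1 \<inter> g ` ball 0 r = cball 0 1"
    using connected_clopen[of "cball (0::complex) 1"] by (metis connected_cball empty_iff)
  then have "1 \<in> g ` ball 0 r"
    by (metis IntE mem_cball_0 norm_one order_refl)
  then show False
    using n1 r by auto
qed

text \<open>Rotating \<open>g\<close> moves its small value to a fixed point, so that the bound is uniform in \<open>g\<close>.\<close>
lemma bounded_zero_only_at_0_omits_1:
  assumes r: "0 < r" "r < 1"
  obtains B where "\<And>g z. \<lbrakk>g holomorphic_on ball 0 1; g 0 = 0;
      \<And>t. t \<in> ball 0 1 - {0} \<Longrightarrow> g t \<noteq> 0; \<And>t. t \<in> ball 0 1 \<Longrightarrow> g t \<noteq> 1; norm z \<le> r\<rbrakk>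
      \<Longrightarrow> norm (g z) \<le> B"
proof -
  define X where "X = {g. g holomorphic_on ball 0 1 \<and> g 0 = 0 \<and>
      (\<forall>t \<in> ball 0 1 - {0}. g t \<noteq> 0) \<and> (\<forall>t \<in> ball (0::complex) 1. g t \<noteq> (1::complex))}"
  \<comment> \<open>The omitted values 0 and 1 are both available only on the punctured disc, so the
    Schottky-type theorem \<open>GPicard3\<close> is applied there, normalised at the fixed point
    \<open>r\<close>. It bounds the circle; the maximum principle then covers the closed disc,
    including 0.\<close>
  obtain B where B: "\<And>h z. \<lbrakk>h \<in> {g \<in> X. norm (g (of_real r)) \<le> 1}; z \<in> sphere 0 r\<rbrakk>
      \<Longrightarrow> norm (h z) \<le> B"
  proof (rule GPicard3[of "ball 0 1 - {0}" "of_real r" "{g \<in> X. norm (g (of_real r)) \<le> 1}" X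
        "sphere 0 r"])
    show "connected (ball (0::complex) 1 - {0})"
      by (simp add: connected_open_delete)
    show "h holomorphic_on ball 0 1 - {0}" if "h \<in> X" for h
      using that by (auto simp: X_def intro: holomorphic_on_subset)
  qed (use r in \<open>auto simp: X_def\<close>)
  show thesis
  proof
    fix g z
    assume hol: "g holomorphic_on ball 0 1" and g0: "g 0 = 0"
      and nz: "\<And>t. t \<in> ball 0 1 - {0} \<Longrightarrow> g t \<noteq> 0"
      and n1: "\<And>t. t \<in> ball 0 1 \<Longrightarrow> g t \<noteq> 1" and z: "norm (z::complex) \<le> r"
    obtain t where t: "norm t = r" "norm (g t) \<le> 1"
      using small_value_on_circle[OF r hol g0 nz n1] by blast
    define u where "u = t / of_real r"
    have u: "norm u = 1" "u \<noteq> 0"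
      using t r by (auto simp: u_def norm_divide)
    have rot: "(\<lambda>z. g (u * z)) \<in> {g \<in> X. norm (g (of_real r)) \<le> 1}"
    proof -
      have "(g \<circ> (\<lambda>z. u * z)) holomorphic_on ball 0 1"
        using u by (intro holomorphic_on_compose holomorphic_intros holomorphic_on_subset[OF hol])
          (auto simp: norm_mult)
      moreover have "g (u * of_real r) = g t"
        using r by (simp add: u_def)
      ultimately show ?thesis
        using u g0 nz n1 t by (auto simp: X_def o_def norm_mult)
    qed
    \<comment> \<open>Dividing by the unimodular \<open>u\<close> undoes the rotation:
      \<open>y / u\<close> is again on the circle of radius \<open>r\<close>.\<close>
    have circ: "norm (g y) \<le> B" if "norm y = r" for y
      using B[OF rot, of "y / u"] that u by (auto simp: norm_divide)
    show "norm (g z) \<le> B"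
    proof (rule maximum_modulus_frontier[of g "cball 0 r"])
      show "g holomorphic_on interior (cball 0 r)"
        using r by (intro holomorphic_on_subset[OF hol]) auto
      show "continuous_on (closure (cball 0 r)) g"
        using r by (intro holomorphic_on_imp_continuous_on holomorphic_on_subset[OF hol]) auto
    qed (use z circ in auto)
  qed
qed

section \<open>Normality of the Hurwitz family and existence of extremal maps\<close>

text \<open>For a point \<open>c\<close> outside \<open>\<Omega>\<close>, the affine change (h -
  w)/(c - w) turns the omitted value \<open>c\<close> into 1 and the value \<open>w\<close>, taken
  only at 0, into 0. This reduces the claim to the preceding bound.\<close>

lemma hurwitz_family_bounded:
  assumes "c \<notin> \<Omega>" "w \<in> \<Omega>" and r: "0 < r" "r < 1"
  obtains B where "\<And>h z. \<lbrakk>h \<in> hurwitz_family w \<Omega>; norm z \<le> r\<rbrakk> \<Longrightarrow> norm (h z) \<le> B"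
proof -
  have cw: "c - w \<noteq> 0"
    using assms by auto
  obtain B where B: "\<And>g z. \<lbrakk>g holomorphic_on ball 0 1; g 0 = 0;
      \<And>t. t \<in> ball 0 1 - {0} \<Longrightarrow> g t \<noteq> 0; \<And>t. t \<in> ball 0 1 \<Longrightarrow> g t \<noteq> 1; norm z \<le> r\<rbrakk>
      \<Longrightarrow> norm (g z) \<le> B"
    by (rule bounded_zero_only_at_0_omits_1[OF r]) blast
  show thesis
  proof
    fix h z assume h: "h \<in> hurwitz_family w \<Omega>" and z: "norm (z::complex) \<le> r"
    have "norm ((h z - w) / (c - w)) \<le> B"
    proof (rule B[OF _ _ _ _ z])
      show "(\<lambda>z. (h z - w) / (c - w)) holomorphic_on ball 0 1"
        using h by (auto simp: hurwitz_family_def intro!: holomorphic_intros)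
      show "(h t - w) / (c - w) \<noteq> 1" if "t \<in> ball 0 1" for t
        using h assms(1) cw that by (auto simp: hurwitz_family_def image_subset_iff)
    qed (use h cw in \<open>auto simp: hurwitz_family_def\<close>)
    then have "norm (h z - w) \<le> B * norm (c - w)"
      using cw by (simp add: norm_divide divide_simps)
    then show "norm (h z) \<le> norm w + B * norm (c - w)"
      using norm_triangle_sub[of "h z" w] by linarith
  qed
qed

text \<open>Precomposition with a rotation of the disc makes the derivative at 0 positive without
  changing its modulus, the image, or the fact that \<open>w\<close> is taken only at 0.\<close>

lemma hurwitz_family_normalize:
  assumes hol: "h holomorphic_on ball 0 1" and sub: "h ` ball 0 1 \<subseteq> \<Omega>" and "h 0 = w"
    and nw: "\<And>t. t \<in> ball 0 1 - {0} \<Longrightarrow> h t \<noteq> w" and d: "deriv h 0 \<noteq> 0"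
  obtains g where "g \<in> hurwitz_family w \<Omega>" "Re (deriv g 0) = norm (deriv h 0)"
proof -
  define u where "u = of_real (norm (deriv h 0)) / deriv h 0"
  have u: "norm u = 1" "u \<noteq> 0"
    using d by (auto simp: u_def norm_divide)
  have dh: "(h has_field_derivative deriv h 0) (at (u * 0))"
    using hol by (auto intro: holomorphic_derivI)
  have "((h \<circ> (\<lambda>z. u * z)) has_field_derivative deriv h 0 * u) (at 0)"
    by (rule DERIV_chain[where g = "\<lambda>z. u * z", OF dh]) (auto intro!: derivative_eq_intros)
  then have "deriv (h \<circ> (\<lambda>z. u * z)) 0 = of_real (norm (deriv h 0))"
    using d by (simp add: DERIV_imp_deriv u_def)
  moreover have "(h \<circ> (\<lambda>z. u * z)) holomorphic_on ball 0 1"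
    using u by (intro holomorphic_on_compose holomorphic_intros holomorphic_on_subset[OF hol])
      (auto simp: norm_mult)
  ultimately have "h \<circ> (\<lambda>z. u * z) \<in> hurwitz_family w \<Omega>"
    using assms u by (auto simp: hurwitz_family_def norm_mult image_subset_iff)
  then show thesis
    using that \<open>deriv (h \<circ> (\<lambda>z. u * z)) 0 = _\<close> by simp
qed

text \<open>Since \<open>hurwitz_radius\<close> is a \<open>GREATEST\<close>, nothing can be derived
  from it until a maximum is exhibited. It is identified here with \<open>Sup R\<close>, which is
  finite by Cauchy's estimate on the disc of radius 1/2 and is realised by a locally uniform limit
  of a maximising sequence.\<close>

lemma hurwitz_radius_attained:
  assumes \<Omega>: "proper_subdomain \<Omega>" and w: "w \<in> \<Omega>"
  obtains f where "f \<in> hurwitz_family w \<Omega>" "Re (deriv f 0) = hurwitz_radius \<Omega> w"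
    "\<And>h. h \<in> hurwitz_family w \<Omega> \<Longrightarrow> Re (deriv h 0) \<le> hurwitz_radius \<Omega> w"
proof -
  have "open \<Omega>"
    using \<Omega> by (simp add: proper_subdomain_def plane_domain_def)
  obtain c where c: "c \<notin> \<Omega>"
    using \<Omega> by (auto simp: proper_subdomain_def)
  define R where "R = (\<lambda>h. Re (deriv h 0)) ` hurwitz_family w \<Omega>"
  have ne: "R \<noteq> {}"
  proof -
    obtain e where e: "e > 0" "ball w e \<subseteq> \<Omega>"
      using \<open>open \<Omega>\<close> w openE by blast
    have "((\<lambda>z. w + of_real e * z) has_field_derivative of_real e) (at 0)"
      by (auto intro!: derivative_eq_intros)
    then have "(\<lambda>z. w + of_real e * z) \<in> hurwitz_family w \<Omega>"
      using e by (auto simp: hurwitz_family_def DERIV_imp_deriv dist_norm norm_mult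
          intro!: holomorphic_intros subsetD[OF e(2)])
    then show ?thesis
      by (auto simp: R_def)
  qed
  have bdd: "bdd_above R"
  proof -
    obtain B where B: "\<And>h z. \<lbrakk>h \<in> hurwitz_family w \<Omega>; norm z \<le> 1/2\<rbrakk> \<Longrightarrow> norm (h z) \<le> B"
      using hurwitz_family_bounded[OF c w, of "1/2"] by auto
    have "Re (deriv h 0) \<le> B / (1/2)" if h: "h \<in> hurwitz_family w \<Omega>" for h
    proof -
      have hol: "h holomorphic_on ball 0 1"
        using h by (simp add: hurwitz_family_def)
      have "norm ((deriv ^^ 1) h 0) \<le> fact 1 * B / (1/2) ^ 1"
      proof (rule Cauchy_inequality)
        show "h holomorphic_on ball 0 (1/2)"
          by (rule holomorphic_on_subset[OF hol]) auto
        show "continuous_on (cball 0 (1/2)) h"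
          by (rule holomorphic_on_imp_continuous_on[OF holomorphic_on_subset[OF hol]]) auto
      qed (use B[OF h] in auto)
      then show ?thesis
        using complex_Re_le_cmod[of "deriv h 0"] by simp
    qed
    then show ?thesis
      unfolding R_def by (intro bdd_aboveI2)
  qed
  have "\<exists>h \<in> hurwitz_family w \<Omega>. Sup R - inverse (real (Suc n)) < Re (deriv h 0)" for n
    using less_cSup_iff[OF ne bdd, of "Sup R - inverse (real (Suc n))"] by (auto simp: R_def)
  then obtain F where F: "\<And>n. F n \<in> hurwitz_family w \<Omega>"
    and FR: "\<And>n. Sup R - inverse (real (Suc n)) < Re (deriv (F n) 0)"
    by metis
  obtain f k where f: "f holomorphic_on ball 0 1" and k: "strict_mono (k :: nat \<Rightarrow> nat)"
    and lim: "\<And>x. x \<in> ball 0 1 \<Longrightarrow> ((\<lambda>n. F (k n) x) \<longlongrightarrow> f x) sequentially"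
    and ulim: "\<And>K. \<lbrakk>compact K; K \<subseteq> ball 0 1\<rbrakk> \<Longrightarrow> uniform_limit K (F \<circ> k) f sequentially"
  proof (rule Montel[of "ball 0 1" "hurwitz_family w \<Omega>" F])
    fix K :: "complex set" assume K: "compact K" "K \<subseteq> ball 0 1"
    obtain r where r: "0 < r" "r < 1" "K \<subseteq> cball 0 r"
    proof (cases "K = {}")
      case True
      then show ?thesis using that[of "1/2"] by simp
    next
      case False
      obtain x where x: "x \<in> K" "\<And>y. y \<in> K \<Longrightarrow> norm y \<le> norm x"
        using continuous_attains_sup[OF K(1) False, of norm] continuous_on_norm_id by blast
      have "norm x < 1" using x(1) K by auto
      then show ?thesis
        using x(2) by (intro that[of "(norm x + 1) / 2"]) (force simp: add_nonneg_pos)+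
    qed
    obtain B where "\<And>h z. \<lbrakk>h \<in> hurwitz_family w \<Omega>; norm z \<le> r\<rbrakk> \<Longrightarrow> norm (h z) \<le> B"
      by (rule hurwitz_family_bounded[OF c w r(1,2)]) blast
    then show "\<exists>B. \<forall>h\<in>hurwitz_family w \<Omega>. \<forall>z\<in>K. norm (h z) \<le> B"
      using r(3) by (auto simp: subset_iff)
  next
    show "h holomorphic_on ball 0 1" if "h \<in> hurwitz_family w \<Omega>" for h
      using that by (simp add: hurwitz_family_def)
    show "range F \<subseteq> hurwitz_family w \<Omega>"
      using F by blast
  qed auto
  have holF: "F n holomorphic_on ball 0 1" for n
    using F by (simp add: hurwitz_family_def)
  have "((\<lambda>n. deriv ((F \<circ> k) n) 0) \<longlongrightarrow> deriv f 0) sequentially"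
  proof (rule deriv_complex_uniform_limit)
    show "uniform_limit (ball 0 (1/2)) (F \<circ> k) f sequentially"
      by (rule uniform_limit_on_subset[OF ulim[of "cball 0 (1/2)"]]) auto
    show "\<forall>\<^sub>F n in sequentially. (F \<circ> k) n holomorphic_on ball 0 (1/2)"
      by (intro always_eventually allI) (auto intro: holomorphic_on_subset[OF holF])
  qed auto
  then have dlim: "(\<lambda>n. deriv (F (k n)) 0) \<longlonglongrightarrow> deriv f 0"
    by simp
  have dR: "deriv f 0 \<in> \<real>"
    by (rule closed_sequentially[OF closed_complex_Reals _ dlim]) (use F in \<open>auto simp: hurwitz_family_def\<close>)
  have relim: "(\<lambda>n. Re (deriv (F (k n)) 0)) \<longlonglongrightarrow> Re (deriv f 0)"
    using dlim by (rule tendsto_Re)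
  have "(\<lambda>n. Re (deriv (F n) 0)) \<longlonglongrightarrow> Sup R"
  proof (rule tendsto_sandwich)
    show "(\<lambda>n. Sup R - inverse (real (Suc n))) \<longlonglongrightarrow> Sup R"
      using tendsto_diff[OF tendsto_const LIMSEQ_inverse_real_of_nat] by simp
    show "\<forall>\<^sub>F n in sequentially. Re (deriv (F n) 0) \<le> Sup R"
      using F bdd by (auto simp: R_def intro!: always_eventually cSup_upper)
  qed (use FR in \<open>auto intro!: always_eventually less_imp_le\<close>)
  then have "(\<lambda>n. Re (deriv (F (k n)) 0)) \<longlonglongrightarrow> Sup R"
    using LIMSEQ_subseq_LIMSEQ[OF _ k, of "\<lambda>n. Re (deriv (F n) 0)"] by (simp add: o_def)
  with relim have dsup: "Re (deriv f 0) = Sup R"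
    using LIMSEQ_unique by blast
  have upper: "Re (deriv h 0) \<le> Sup R" if "h \<in> hurwitz_family w \<Omega>" for h
    using that bdd by (auto simp: R_def intro!: cSup_upper)
  \<comment> \<open>Passing to the limit alone would give only a nonnegative derivative; strictness
    comes from comparing \<open>Sup R\<close> with the positive derivative of
    \<open>F 0\<close>.\<close>
  have pos: "Re (deriv f 0) > 0"
    using upper[OF F[of 0]] F[of 0] unfolding dsup by (simp add: hurwitz_family_def)
  have f0: "f 0 = w"
  proof -
    have "(\<lambda>n. F (k n) 0) = (\<lambda>n. w)"
      using F by (auto simp: hurwitz_family_def)
    then show ?thesis
      using lim[of 0] by (simp add: LIMSEQ_const_iff)
  qed
  \<comment> \<open>Hurwitz's theorem needs a nonconstant limit. If \<open>f\<close> were constant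
    on the punctured disc, continuity would make it constant at 0 too, contradicting the positive
    derivative.\<close>
  have nonconst: "\<not> (\<lambda>z. f z - d) constant_on S" if "S = ball 0 1 \<or> S = ball 0 1 - {0}" for d S
  proof
    assume "(\<lambda>z. f z - d) constant_on S"
    then obtain a where a: "\<And>z. z \<in> S \<Longrightarrow> f z - d = a"
      unfolding constant_on_def by blast
    have off0: "f z = a + d" if "z \<in> ball 0 1 - {0}" for z
      using a[of z] that \<open>S = _ \<or> _\<close> by (auto simp: algebra_simps)
    have cl: "closure (ball 0 (1/2) - {0::complex}) \<subseteq> ball 0 1"
      by (rule order.trans[OF closure_mono[of _ "ball 0 (1/2)"]]) auto
    have "f 0 = a + d"
    proof (rule continuous_constant_on_closure[of "ball 0 (1/2) - {0}" f "a + d" 0])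
      show "continuous_on (closure (ball 0 (1/2) - {0})) f"
        using cl by (intro holomorphic_on_imp_continuous_on holomorphic_on_subset[OF f])
      show "0 \<in> closure (ball 0 (1/2) - {0::complex})"
        by (simp add: islimpt_in_closure[symmetric] islimpt_ball)
    qed (use off0 in auto)
    then have "deriv f 0 = deriv (\<lambda>z. a + d) 0"
      using off0 by (intro complex_derivative_transform_within_open[of _ "ball 0 1"] f) auto
    then show False
      using pos by simp
  qed
  \<comment> \<open>Hurwitz's theorem is prepared for two uses: on the disc for values outside
    \<open>\<Omega>\<close>, and on the punctured disc for the value \<open>w\<close>.\<close>
  have avoid: "f z \<noteq> d"
    if S: "S = ball 0 1 \<or> S = ball 0 1 - {0}" and z: "z \<in> S"
      and nd: "\<And>n z. z \<in> S \<Longrightarrow> F n z \<noteq> d" for d z S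
  proof -
    have "f z - d \<noteq> 0"
    proof (rule Hurwitz_no_zeros[of S "\<lambda>n z. F (k n) z - d" "\<lambda>z. f z - d" z])
      show "open S" "connected S"
        using S by (auto simp: open_delete connected_open_delete)
      show "(\<lambda>z. F (k n) z - d) holomorphic_on S" for n
        using S by (intro holomorphic_intros holomorphic_on_subset[OF holF]) auto
      show "(\<lambda>z. f z - d) holomorphic_on S"
        using S by (intro holomorphic_intros holomorphic_on_subset[OF f]) auto
      show "uniform_limit K (\<lambda>n z. F (k n) z - d) (\<lambda>z. f z - d) sequentially"
        if "compact K" "K \<subseteq> S" for K
        using ulim[of K] that S by (intro uniform_limit_intros) (auto simp: o_def)
      show "\<not> (\<lambda>z. f z - d) constant_on S"
        using S by (rule nonconst)
      show "F (k n) x - d \<noteq> 0" if "x \<in> S" for n x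
        using nd[OF that] by simp
    qed fact
    then show ?thesis by simp
  qed
  have mem: "f \<in> hurwitz_family w \<Omega>"
  proof -
    have "F n z \<in> \<Omega>" if "z \<in> ball 0 1" for n z
      using F[of n] that unfolding hurwitz_family_def by blast
    \<comment> \<open>Taking \<open>d = f z\<close> in \<open>avoid\<close>: since \<open>f\<close>
      takes this value, some \<open>F n\<close> takes it on the disc as well, so it lies in
      \<open>\<Omega>\<close>.\<close>
    then have "f z \<in> \<Omega>" if "z \<in> ball 0 1" for z
      using avoid[of "ball 0 1" z "f z"] that by metis
    moreover have "F n z \<noteq> w" if "z \<in> ball 0 1 - {0}" for n z
      using F[of n] that unfolding hurwitz_family_def by blast
    then have "f z \<noteq> w" if "z \<in> ball 0 1 - {0}" for z
      using avoid[of "ball 0 1 - {0}" z w] that by metis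
    ultimately show ?thesis
      using f f0 dR pos by (auto simp: hurwitz_family_def)
  qed
  have "hurwitz_radius \<Omega> w = Sup R"
    unfolding hurwitz_radius_def R_def[symmetric]
  proof (rule Greatest_equality)
    show "Sup R \<in> R"
      using mem dsup by (force simp: R_def)
    show "y \<le> Sup R" if "y \<in> R" for y
      using that bdd by (rule cSup_upper)
  qed
  then show thesis
    using that[OF mem] dsup upper by simp
qed

section \<open>Lifting holomorphic maps through a covering of punctured domains\<close>

text \<open>Near \<open>g t\<close> the map \<open>h\<close> has a holomorphic inverse
  \<open>k\<close>. Continuity keeps \<open>g\<close> in the domain of injectivity on a
  neighbourhood of \<open>t\<close>, where therefore \<open>g = k \<circ> f\<close>.\<close>

lemma continuous_lift_holomorphic:
  assumes "open S" "open C" and h: "h holomorphic_on C"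
    and dh: "\<And>y. y \<in> C \<Longrightarrow> deriv h y \<noteq> 0"
    and g: "continuous_on S g" "g ` S \<subseteq> C"
    and f: "f holomorphic_on S" "\<And>t. t \<in> S \<Longrightarrow> h (g t) = f t"
  shows "g holomorphic_on S"
proof -
  have "g field_differentiable at t" if t: "t \<in> S" for t
  proof -
    have gt: "g t \<in> C" using g t by auto
    obtain r where r: "r > 0" "ball (g t) r \<subseteq> C" "inj_on h (ball (g t) r)"
      by (rule has_complex_derivative_locally_injective[OF h gt \<open>open C\<close> dh[OF gt]])
    have hr: "h holomorphic_on ball (g t) r"
      using h r holomorphic_on_subset by blast
    obtain k where k: "k holomorphic_on h ` ball (g t) r" "\<And>z. z \<in> ball (g t) r \<Longrightarrow> k (h z) = z"
      using holomorphic_has_inverse[OF hr open_ball r(3)] by blast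
    define N where "N = S \<inter> g -` ball (g t) r"
    have N: "open N" "t \<in> N" "N \<subseteq> S"
      using continuous_open_preimage[OF g(1) \<open>open S\<close> open_ball] t r by (auto simp: N_def)
    have "f x \<in> h ` ball (g t) r" if "x \<in> N" for x
      using that f(2)[of x] imageI[of "g x" "ball (g t) r" h] by (simp add: N_def)
    then have "(k \<circ> f) holomorphic_on N"
      using N by (intro holomorphic_on_compose holomorphic_on_subset[OF f(1)]
          holomorphic_on_subset[OF k(1)]) auto
    moreover have "(k \<circ> f) x = g x" if "x \<in> N" for x
      using that k(2)[of "g x"] f(2)[of x] by (auto simp: N_def)
    ultimately have "g holomorphic_on N"
      by (rule holomorphic_transform)
    then show ?thesis
      using N holomorphic_on_imp_differentiable_at by blast
  qed
  then show ?thesis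
    by (simp add: holomorphic_on_def field_differentiable_at_within)
qed

text \<open>A covering is a local homeomorphism, hence locally injective, and an injective
  holomorphic function has no critical points.\<close>

lemma covering_space_holomorphic_deriv_nz:
  assumes cov: "covering_space C h S" and "open C" "h holomorphic_on C" "y \<in> C"
  shows "deriv h y \<noteq> 0"
proof -
  obtain T u q where "y \<in> T" "openin (top_of_set C) T" "homeomorphism T u h q"
    using covering_space_local_homeomorphism[OF cov \<open>y \<in> C\<close>] by metis
  moreover have "open T" "T \<subseteq> C"
    using calculation(2) \<open>open C\<close> by (auto simp: openin_open_eq)
  moreover have "inj_on h T"
    using calculation(3) by (metis homeomorphism_def inj_onI)
  ultimately show ?thesis
    using assms(3) by (meson holomorphic_injective_imp_regular holomorphic_on_subset)
qed

text \<open>The radial retraction onto the closed ball of radius \<open>norm z\<close> fixes the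
  base point, which lies on its boundary. It moves every point along its own ray, so the
  straight-line homotopy never meets 0.\<close>

lemma punctured_disc_loop_shrink:
  fixes z :: "'a::real_normed_vector"
  assumes r: "path r" "path_image r \<subseteq> ball 0 1 - {0}" "pathstart r = z" "pathfinish r = z"
  obtains q where "path q" "path_image q \<subseteq> cball 0 (norm z) - {0}"
    "pathstart q = z" "pathfinish q = z" "homotopic_paths (ball 0 1 - {0}) r q"
proof -
  have z0: "z \<noteq> 0"
    using r pathstart_in_path_image[of r] by auto
  define s where "s t = min 1 (norm z / norm t)" for t :: 'a
  define q where "q = (\<lambda>t. s t *\<^sub>R t) \<circ> r"
  have s: "0 < s t" "s t \<le> 1" "s t * norm t \<le> norm z" if "t \<noteq> 0" for t
    using that z0 by (auto simp: s_def min_def divide_simps)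
  have rt: "r t \<noteq> 0" "norm (r t) < 1" if "t \<in> {0..1}" for t
    using r(2) that by (auto simp: path_image_def image_subset_iff)
  have "continuous_on (path_image r) (\<lambda>t. s t *\<^sub>R t)"
    unfolding s_def using r(2) by (intro continuous_intros) auto
  then have pq: "path q"
    unfolding q_def using r(1) by (rule path_continuous_image[rotated])
  have ends: "pathstart q = z" "pathfinish q = z"
    using r(3,4) z0 by (auto simp: q_def s_def pathstart_def pathfinish_def)
  have "path_image q \<subseteq> cball 0 (norm z) - {0}"
    using s rt by (fastforce simp: path_image_def q_def)
  moreover have "homotopic_paths (ball 0 1 - {0}) r q"
  proof (rule homotopic_paths_linear)
    fix t :: real assume t: "t \<in> {0..1}"
    show "closed_segment (r t) (q t) \<subseteq> ball 0 1 - {0}"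
    proof
      fix x assume "x \<in> closed_segment (r t) (q t)"
      then obtain u where u: "0 \<le> u" "u \<le> 1" "x = (1 - u) *\<^sub>R r t + u *\<^sub>R q t"
        by (auto simp: in_segment)
      \<comment> \<open>A point of the segment is a multiple of \<open>r t\<close> whose factor is a
        convex combination of 1 and \<open>s (r t)\<close>, hence lies in (0, 1].\<close>
      define c where "c = (1 - u) + u * s (r t)"
      have x: "x = c *\<^sub>R r t"
        by (simp add: u(3) q_def c_def algebra_simps)
      have "0 < c"
      proof (cases "u = 1")
        case False
        then show ?thesis
          using u s[OF rt(1)[OF t]] by (simp add: c_def add_pos_nonneg)
      qed (use s[OF rt(1)[OF t]] in \<open>simp add: c_def\<close>)
      moreover have "c \<le> 1"
        using u s[OF rt(1)[OF t]] by (simp add: c_def mult_left_le)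
      ultimately have "c * norm (r t) < 1"
        using rt[OF t] by (smt (verit) mult_left_le_one_le norm_ge_zero)
      then show "x \<in> ball 0 1 - {0}"
        using rt[OF t] \<open>0 < c\<close> by (auto simp: x)
    qed
  qed (use r pq ends in auto)
  ultimately show thesis
    using that[OF pq] ends by blast
qed

text \<open>The punctured disc is not simply connected, so a lift needs a condition on loops. The
  nonzero derivative at \<open>a\<close> supplies it: if \<open>h\<close> were branched there, as
  z^2 is at 0, the identity of the disc would have no lift.\<close>

lemma holomorphic_lift_through_punctured_covering:
  assumes "open Y" and a: "a \<in> Y" and h: "h holomorphic_on Y"
    and cov: "covering_space (Y - {a}) h (\<Omega> - {b})"
    and ha: "h a = b" "deriv h a \<noteq> 0"
    and f: "f holomorphic_on ball 0 1" "f 0 = b" "f ` (ball 0 1 - {0}) \<subseteq> \<Omega> - {b}"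
  obtains F where "F holomorphic_on ball 0 1" "F 0 = a" "F ` (ball 0 1 - {0}) \<subseteq> Y - {a}"
    "\<And>t. t \<in> ball 0 1 \<Longrightarrow> h (F t) = f t"
proof -
  let ?D = "ball (0::complex) 1 - {0}"
  obtain \<rho> where \<rho>: "\<rho> > 0" "ball a \<rho> \<subseteq> Y" "inj_on h (ball a \<rho>)"
    by (rule has_complex_derivative_locally_injective[OF h a \<open>open Y\<close> ha(2)])
  have h\<rho>: "h holomorphic_on ball a \<rho>"
    using h \<rho>(2) holomorphic_on_subset by blast
  obtain k where k: "k holomorphic_on h ` ball a \<rho>" "\<And>y. y \<in> ball a \<rho> \<Longrightarrow> k (h y) = y"
    using holomorphic_has_inverse[OF h\<rho> open_ball \<rho>(3)] by blast
  have contf: "continuous_on (ball 0 1) f"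
    using f(1) by (rule holomorphic_on_imp_continuous_on)
  have "open (h ` ball a \<rho>)"
    by (rule open_mapping_thm3[OF h\<rho> open_ball \<rho>(3)])
  then have "open (ball 0 1 \<inter> f -` (h ` ball a \<rho>))"
    using continuous_open_preimage[OF contf open_ball] by blast
  moreover have "0 \<in> ball 0 1 \<inter> f -` (h ` ball a \<rho>)"
    using imageI[of a "ball a \<rho>" h] f(2) ha(1) \<rho>(1) by simp
  \<comment> \<open>On \<open>ball 0 \<epsilon>\<close> the values of \<open>f\<close> stay in the
    domain of the local inverse \<open>k\<close>, so \<open>k \<circ> f\<close> is an explicit lift
    there.\<close>
  ultimately obtain \<epsilon> where \<epsilon>: "\<epsilon> > 0" "ball 0 \<epsilon> \<subseteq> ball 0 1 \<inter> f -` (h ` ball a \<rho>)"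
    by (rule openE)
  have kf: "k (f t) \<in> ball a \<rho>" "h (k (f t)) = f t" if t: "t \<in> ball 0 \<epsilon>" for t
  proof -
    obtain y where "y \<in> ball a \<rho>" "f t = h y"
      using \<epsilon>(2) t by blast
    then show "k (f t) \<in> ball a \<rho>" "h (k (f t)) = f t"
      using k(2) by auto
  qed
  have kf_in: "k (f t) \<in> Y - {a}" if t: "t \<in> ball 0 \<epsilon> - {0}" for t
  proof -
    have "t \<in> ?D" using t \<epsilon>(2) by blast
    then have "f t \<noteq> b" using f(3) by blast
    then have "k (f t) \<noteq> a" using kf(2)[of t] t ha(1) by auto
    then show ?thesis using kf(1)[of t] t \<rho>(2) by auto
  qed
  have holkf: "(k \<circ> f) holomorphic_on ball 0 \<epsilon>"
    using \<epsilon>(2) by (intro holomorphic_on_compose holomorphic_on_subset[OF f(1)]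
        holomorphic_on_subset[OF k(1)]) auto
  then have contkf: "continuous_on (ball 0 \<epsilon>) (k \<circ> f)"
    by (rule holomorphic_on_imp_continuous_on)
  \<comment> \<open>The base point is chosen in the small disc, so that loops at \<open>z\<close>
    shrink to loops where \<open>k \<circ> f\<close> is available.\<close>
  define z where "z = complex_of_real (\<epsilon> / 2)"
  have z: "z \<in> ball 0 \<epsilon> - {0}"
    using \<epsilon> by (auto simp: z_def)
  then have zD: "z \<in> ?D"
    using \<epsilon>(2) by blast
  have contD: "continuous_on ?D f"
    using contf by (rule continuous_on_subset) auto
  \<comment> \<open>The lifting criterion asks, for every loop \<open>r\<close> at \<open>z\<close>,
    for a closed loop upstairs projecting to a loop homotopic to \<open>f \<circ> r\<close>.
    Shrinking \<open>r\<close> to \<open>q\<close> and applying \<open>k \<circ> f\<close> gives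
    one.\<close>
  obtain g where g: "continuous_on ?D g" "g \<in> ?D \<rightarrow> Y - {a}" "g z = k (f z)"
      "\<And>y. y \<in> ?D \<Longrightarrow> h (g y) = f y"
  proof (rule covering_space_lift_general[OF cov, of "k (f z)" z ?D f])
    show "path_connected ?D"
      by (intro connected_open_path_connected connected_open_delete) auto
    show "locally path_connected ?D"
      by (intro open_imp_locally_path_connected) auto
    fix r assume r: "path r" "path_image r \<subseteq> ?D" "pathstart r = z" "pathfinish r = z"
    obtain q where q: "path q" "path_image q \<subseteq> cball 0 (norm z) - {0}"
      "pathstart q = z" "pathfinish q = z" "homotopic_paths ?D r q"
      using punctured_disc_loop_shrink[OF r] .
    have qD: "path_image q \<subseteq> ball 0 \<epsilon> - {0}"
      using q(2) z by fastforce
    have pq: "path (k \<circ> f \<circ> q)"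
      using q(1) qD by (intro path_continuous_image continuous_on_subset[OF contkf]) auto
    moreover have "path_image (k \<circ> f \<circ> q) \<subseteq> Y - {a}"
      unfolding path_image_compose image_subset_iff using qD kf_in by force
    moreover have "homotopic_paths (\<Omega> - {b}) (f \<circ> r) (h \<circ> (k \<circ> f \<circ> q))"
    proof (rule homotopic_paths_trans)
      show hom: "homotopic_paths (\<Omega> - {b}) (f \<circ> r) (f \<circ> q)"
        using q(5) contD f(3) by (intro homotopic_paths_continuous_image[of ?D]) auto
      show "homotopic_paths (\<Omega> - {b}) (f \<circ> q) (h \<circ> (k \<circ> f \<circ> q))"
      proof (rule homotopic_paths_eq)
        show "path (f \<circ> q)" "path_image (f \<circ> q) \<subseteq> \<Omega> - {b}"
          using homotopic_paths_imp_path[OF hom] homotopic_paths_imp_subset[OF hom] by auto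
        show "(f \<circ> q) t = (h \<circ> (k \<circ> f \<circ> q)) t" if "t \<in> {0..1}" for t
          using kf(2)[of "q t"] qD that by (simp add: path_image_def image_subset_iff)
      qed
    qed
    ultimately show "\<exists>q. path q \<and> path_image q \<subseteq> Y - {a} \<and> pathstart q = k (f z) \<and>
        pathfinish q = k (f z) \<and> homotopic_paths (\<Omega> - {b}) (f \<circ> r) (h \<circ> q)"
      using q(3,4) by (intro exI[of _ "k \<circ> f \<circ> q"]) (auto simp: pathstart_compose pathfinish_compose)
  next
    show "k (f z) \<in> Y - {a}" "f z = h (k (f z))"
      using kf_in[OF z] kf(2)[of z] z by simp_all
    show "f \<in> ?D \<rightarrow> \<Omega> - {b}"
      using f(3) by blast
  qed (use contD zD in blast)+
  \<comment> \<open>Both are lifts of \<open>f\<close> on a connected punctured disc and agree at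
    \<open>z\<close>. Hence \<open>g\<close> extends over 0 as \<open>k \<circ> f\<close>, with
    value \<open>a\<close>.\<close>
  have eq: "g t = k (f t)" if t: "t \<in> ball 0 \<epsilon> - {0}" for t
  proof -
    have sub: "ball 0 \<epsilon> - {0} \<subseteq> ?D"
      using \<epsilon>(2) by auto
    have "g t = (k \<circ> f) t"
    proof (rule covering_space_lift_unique[OF cov, of g z "k \<circ> f" "ball 0 \<epsilon> - {0}" f t])
      show "continuous_on (ball 0 \<epsilon> - {0}) f" "continuous_on (ball 0 \<epsilon> - {0}) g"
        using contD g(1) sub continuous_on_subset by blast+
      show "continuous_on (ball 0 \<epsilon> - {0}) (k \<circ> f)"
        by (rule continuous_on_subset[OF contkf]) auto
      show "connected (ball (0::complex) \<epsilon> - {0})"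
        by (simp add: connected_open_delete)
      show "f \<in> ball 0 \<epsilon> - {0} \<rightarrow> \<Omega> - {b}" "g \<in> ball 0 \<epsilon> - {0} \<rightarrow> Y - {a}"
        using f(3) g(2) sub by blast+
      show "f x = h (g x)" if "x \<in> ball 0 \<epsilon> - {0}" for x
        using g(4) sub that by fastforce
      show "g z = (k \<circ> f) z"
        using g(3) by simp
      show "k \<circ> f \<in> ball 0 \<epsilon> - {0} \<rightarrow> Y - {a}"
        using kf_in by simp
      show "f x = h ((k \<circ> f) x)" if "x \<in> ball 0 \<epsilon> - {0}" for x
        using kf(2)[of x] that by simp
    qed (use t z in blast)+
    then show ?thesis by simp
  qed
  define F where "F = (\<lambda>t. if t = 0 then a else g t)"
  have "g holomorphic_on ?D"
  proof (rule continuous_lift_holomorphic[of ?D "Y - {a}" h g f])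
    show "h holomorphic_on Y - {a}"
      using h by (rule holomorphic_on_subset) auto
    then show "deriv h y \<noteq> 0" if "y \<in> Y - {a}" for y
      using covering_space_holomorphic_deriv_nz[OF cov] \<open>open Y\<close> that by (auto simp: open_delete)
    show "f holomorphic_on ?D"
      using f(1) by (rule holomorphic_on_subset) auto
  qed (use g \<open>open Y\<close> in \<open>auto simp: open_delete\<close>)
  then have "F holomorphic_on ?D"
    by (rule holomorphic_transform) (auto simp: F_def)
  moreover have "F holomorphic_on ball 0 \<epsilon>"
    by (rule holomorphic_transform[OF holkf])
      (use eq k(2)[of a] \<rho>(1) ha f(2) in \<open>auto simp: F_def\<close>)
  moreover have "ball 0 1 = ?D \<union> ball 0 \<epsilon>"
    using \<epsilon> by auto
  ultimately have "F holomorphic_on ball 0 1"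
    by (metis holomorphic_on_Un open_ball open_delete)
  moreover have "h (F t) = f t" if "t \<in> ball 0 1" for t
    using that g(4) ha(1) f(2) by (auto simp: F_def)
  moreover have "F ` ?D \<subseteq> Y - {a}"
    using g(2) by (auto simp: F_def)
  ultimately show thesis
    using that[of F] by (simp add: F_def)
qed

section \<open>Comparison of Hurwitz densities and the equality\<close>

lemma deriv_comp_at_0:
  assumes "g holomorphic_on ball 0 1" "h holomorphic_on Y" "open Y" "g 0 \<in> Y"
  shows "deriv (h \<circ> g) 0 = deriv h (g 0) * deriv g 0"
  using assms by (intro deriv_chain) (auto intro: holomorphic_on_imp_differentiable_at)

lemma hurwitz_radius_pos:
  assumes "proper_subdomain \<Omega>" "w \<in> \<Omega>"
  shows "0 < hurwitz_radius \<Omega> w"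
  using hurwitz_radius_attained[OF assms] by (smt (verit) hurwitz_family_def mem_Collect_eq)

text \<open>This frees the extremal property from the normalisation of the derivative: a zero
  derivative is trivial, and any other is made positive by a rotation.\<close>

lemma hurwitz_radius_ge:
  assumes \<Omega>: "proper_subdomain \<Omega>" "w \<in> \<Omega>"
    and h: "h holomorphic_on ball 0 1" "h ` ball 0 1 \<subseteq> \<Omega>" "h 0 = w"
      "\<And>t. t \<in> ball 0 1 - {0} \<Longrightarrow> h t \<noteq> w"
  shows "norm (deriv h 0) \<le> hurwitz_radius \<Omega> w"
proof (cases "deriv h 0 = 0")
  case True
  then show ?thesis
    using hurwitz_radius_pos[OF \<Omega>] by simp
next
  case False
  obtain g where "g \<in> hurwitz_family w \<Omega>" "Re (deriv g 0) = norm (deriv h 0)"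
    using hurwitz_family_normalize[OF h False] by blast
  then show ?thesis
    using hurwitz_radius_attained[OF \<Omega>] by metis
qed

text \<open>Compose \<open>h\<close> with an extremal map \<open>g\<close> for \<open>Y\<close> at
  \<open>s\<close>. The composite takes the value \<open>w\<close> only at 0, because
  \<open>h\<close> takes it only at \<open>s\<close> and \<open>g\<close> reaches \<open>s\<close>
  only at 0; so it competes for \<open>\<Omega>\<close> at \<open>w\<close>.\<close>

lemma hurwitz_density_le_of_map:
  assumes \<Omega>: "proper_subdomain \<Omega>" and Y: "proper_subdomain Y" and s: "s \<in> Y"
    and h: "h holomorphic_on Y" "h ` Y \<subseteq> \<Omega>" "h s = w" "\<And>t. t \<in> Y - {s} \<Longrightarrow> h t \<noteq> w"
    and d: "deriv h s \<noteq> 0"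
  shows "hurwitz_density \<Omega> w \<le> hurwitz_density Y s / norm (deriv h s)"
proof -
  have "open Y" and w: "w \<in> \<Omega>"
    using Y s h(2,3) by (auto simp: proper_subdomain_def plane_domain_def)
  obtain g where g: "g \<in> hurwitz_family s Y" "Re (deriv g 0) = hurwitz_radius Y s"
    using hurwitz_radius_attained[OF Y s] by blast
  then have hol: "g holomorphic_on ball 0 1" and im: "g ` ball 0 1 \<subseteq> Y" and g0: "g 0 = s"
    and gs: "\<And>t. t \<in> ball 0 1 - {0} \<Longrightarrow> g t \<noteq> s"
    by (auto simp: hurwitz_family_def)
  have "norm (deriv (h \<circ> g) 0) \<le> hurwitz_radius \<Omega> w"
  proof (rule hurwitz_radius_ge[OF \<Omega> w])
    show "(h \<circ> g) holomorphic_on ball 0 1"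
      using hol h(1) im by (rule holomorphic_on_compose_gen)
    show "(h \<circ> g) t \<noteq> w" if "t \<in> ball 0 1 - {0}" for t
      using h(4)[of "g t"] gs[OF that] im that by (auto simp: image_subset_iff)
  qed (use im g0 h in auto)
  moreover have "hurwitz_radius Y s \<le> norm (deriv g 0)"
    using g(2) complex_Re_le_cmod by metis
  ultimately have "norm (deriv h s) * hurwitz_radius Y s \<le> hurwitz_radius \<Omega> w"
    using deriv_comp_at_0[OF hol h(1) \<open>open Y\<close>] g0 s
    by (simp add: norm_mult) (smt (verit) mult_left_mono norm_ge_zero)
  moreover have "0 < norm (deriv h s) * hurwitz_radius Y s"
    using hurwitz_radius_pos[OF Y s] d by simp
  ultimately have "2 / hurwitz_radius \<Omega> w \<le> 2 / (norm (deriv h s) * hurwitz_radius Y s)"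
    by (intro divide_left_mono) auto
  then show ?thesis
    by (simp add: hurwitz_density_def mult.commute)
qed

text \<open>An extremal map \<open>f\<close> for \<open>\<Omega>\<close> at \<open>w\<close> lifts
  to a map \<open>F\<close> that takes the value \<open>a\<close> only at 0, hence competes for
  \<open>Y\<close> at \<open>a\<close>. The chain rule for \<open>h \<circ> F = f\<close> on the
  disc compares the radii.\<close>

lemma hurwitz_density_ge_of_covering:
  assumes \<Omega>: "proper_subdomain \<Omega>" and Y: "proper_subdomain Y" and w: "w \<in> \<Omega>" and a: "a \<in> Y"
    and h: "h holomorphic_on Y" "h a = w" "deriv h a \<noteq> 0"
    and cov: "covering_space (Y - {a}) h (\<Omega> - {w})"
  shows "hurwitz_density Y a / norm (deriv h a) \<le> hurwitz_density \<Omega> w"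
proof -
  have "open Y"
    using Y by (auto simp: proper_subdomain_def plane_domain_def)
  obtain f where f: "f \<in> hurwitz_family w \<Omega>" "Re (deriv f 0) = hurwitz_radius \<Omega> w"
    using hurwitz_radius_attained[OF \<Omega> w] by blast
  have holf: "f holomorphic_on ball 0 1" and f0: "f 0 = w"
    and imf: "f ` (ball 0 1 - {0}) \<subseteq> \<Omega> - {w}"
    using f(1) by (auto simp: hurwitz_family_def)
  obtain F where F: "F holomorphic_on ball 0 1" "F 0 = a" "F ` (ball 0 1 - {0}) \<subseteq> Y - {a}"
    "\<And>t. t \<in> ball 0 1 \<Longrightarrow> h (F t) = f t"
    by (rule holomorphic_lift_through_punctured_covering[OF \<open>open Y\<close> a h(1) cov h(2,3) holf f0 imf])
      blast
  have imF: "F ` ball 0 1 \<subseteq> Y"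
    using F(2,3) a by auto
  have "norm (deriv F 0) \<le> hurwitz_radius Y a"
    using hurwitz_radius_ge[OF Y a F(1) imF F(2)] F(3) by blast
  moreover have "deriv f 0 = deriv h a * deriv F 0"
  proof -
    have "deriv f 0 = deriv (h \<circ> F) 0"
      using F(1,4) holf h(1) imF
      by (intro complex_derivative_transform_within_open[of _ "ball 0 1"]
          holomorphic_on_compose_gen) auto
    then show ?thesis
      using deriv_comp_at_0[OF F(1) h(1) \<open>open Y\<close>] F(2) a by simp
  qed
  moreover have "hurwitz_radius \<Omega> w \<le> norm (deriv f 0)"
    using f(2) complex_Re_le_cmod by metis
  ultimately have "hurwitz_radius \<Omega> w \<le> norm (deriv h a) * hurwitz_radius Y a"
    by (simp add: norm_mult) (smt (verit) mult_left_mono norm_ge_zero)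
  then have "2 / (norm (deriv h a) * hurwitz_radius Y a) \<le> 2 / hurwitz_radius \<Omega> w"
    using hurwitz_radius_pos[OF \<Omega> w] by (intro divide_left_mono) auto
  then show ?thesis
    by (simp add: hurwitz_density_def mult.commute)
qed

text \<open>The covering map is itself a competitor, which bounds the infimum above, while every
  competitor satisfies the lower bound. Only a covering for the single point \<open>w\<close>
  enters.\<close>

lemma gen_hurwitz_density_eq:
  assumes \<Omega>: "proper_subdomain \<Omega>" and Y: "proper_subdomain Y" and w: "w \<in> \<Omega>" and a: "a \<in> Y"
    and h: "h holomorphic_on Y" "h ` Y \<subseteq> \<Omega>" "h a = w" "deriv h a \<noteq> 0"
    and cov: "covering_space (Y - {a}) h (\<Omega> - {w})"
  shows "gen_hurwitz_density Y \<Omega> w = ereal (hurwitz_density \<Omega> w)"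
  unfolding gen_hurwitz_density_def
proof (rule antisym[OF Inf_lower2 Inf_greatest])
  show "ereal (hurwitz_density Y a / norm (deriv h a)) \<le> ereal (hurwitz_density \<Omega> w)"
    using hurwitz_density_ge_of_covering[OF \<Omega> Y w a h(1,3,4) cov] by simp
  have "h t \<noteq> w" if "t \<in> Y - {a}" for t
    using covering_space_imp_surjective[OF cov] that by auto
  with a h show "ereal (hurwitz_density Y a / norm (deriv h a)) \<in>
      {ereal (hurwitz_density Y s / norm (deriv h s)) | s h.
            s \<in> Y \<and> h holomorphic_on Y \<and> h ` Y \<subseteq> \<Omega> \<and> h s = w \<and>
            (\<forall>t \<in> Y - {s}. h t \<noteq> w) \<and> deriv h s \<noteq> 0}"
    by blast
qed (use hurwitz_density_le_of_map[OF \<Omega> Y] in auto)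

theorem proposition3p9:
  shows "(\<forall>\<Omega> Y :: complex set.
            proper_subdomain \<Omega> \<and> proper_subdomain Y \<and>
            (\<forall>b \<in> \<Omega>. \<exists>a \<in> Y. \<exists>h :: complex \<Rightarrow> complex.
               covering_space (Y - {a}) h (\<Omega> - {b}) \<and>
               h holomorphic_on Y \<and> h ` Y = \<Omega> \<and> h a = b \<and> deriv h a \<noteq> 0)
            \<longrightarrow> (\<forall>w \<in> \<Omega>. gen_hurwitz_density Y \<Omega> w = ereal (hurwitz_density \<Omega> w)))
       \<and> (\<forall>\<Omega> :: complex set. proper_subdomain \<Omega>
            \<longrightarrow> (\<forall>w \<in> \<Omega>. gen_hurwitz_density \<Omega> \<Omega> w = ereal (hurwitz_density \<Omega> w)))"
proof (intro conjI allI impI ballI)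
  fix \<Omega> Y :: "complex set" and w :: complex
  assume *: "proper_subdomain \<Omega> \<and> proper_subdomain Y \<and>
            (\<forall>b \<in> \<Omega>. \<exists>a \<in> Y. \<exists>h :: complex \<Rightarrow> complex.
               covering_space (Y - {a}) h (\<Omega> - {b}) \<and>
               h holomorphic_on Y \<and> h ` Y = \<Omega> \<and> h a = b \<and> deriv h a \<noteq> 0)"
    and w: "w \<in> \<Omega>"
  then obtain a h where "a \<in> Y" "covering_space (Y - {a}) h (\<Omega> - {w})"
      "h holomorphic_on Y" "h ` Y = \<Omega>" "h a = w" "deriv h a \<noteq> 0"
    by blast
  with * w show "gen_hurwitz_density Y \<Omega> w = ereal (hurwitz_density \<Omega> w)"
    by (intro gen_hurwitz_density_eq[of _ _ _ a h]) auto
next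
  fix \<Omega> :: "complex set" and w :: complex
  assume "proper_subdomain \<Omega>" "w \<in> \<Omega>"
  then show "gen_hurwitz_density \<Omega> \<Omega> w = ereal (hurwitz_density \<Omega> w)"
    \<comment> \<open>The identity, with \<open>a = w\<close>, is the required covering of the
      punctured domain by itself.\<close>
    by (intro gen_hurwitz_density_eq[of _ _ _ w "\<lambda>z. z"] homeomorphism_imp_covering_space[OF homeomorphism_ident]) auto
qed

end
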